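(* Let $m,n\ge 1$ be integers and let $r$ be an integer such that $\gcd(m,n)=\gcd(m,r-1)=1$ and $r^n\equiv 1\pmod m$. Let $\mathrm{ZM}(m,n,r)=\langle a,b\mid a^m=b^n=1,\ b^{-1}ab=a^r\rangle$. Let $L$ and the subgroups $H_{(m_1,n_1,s)}$, $(m_1,n_1,s)\in L$, be as defined in the context, and put $$L'=\left\{(m_1,n_1,s)\in\mathbb{N}^3 \;\middle|\; m_1\mid \gcd(m,r^{n_1}-1),\ n_1\mid n,\ s=0\right\}.$$ Then $L'\subseteq L$, and the normal subgroup lattice $N(\mathrm{ZM}(m,n,r))$ consists of all subgroups $H_{(m_1,n_1,s)}$ with $(m_1,n_1,s)\in L'$; that is, $$N(\mathrm{ZM}(m,n,r))=\left\{H_{(m_1,n_1,s)} \;\middle|\; (m_1,n_1,s)\in L'\right\}.$$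
   Context: For a group $G$, $L(G)$ denotes the lattice of all subgroups of $G$ and $N(G)$ the lattice of all normal subgroups of $G$, both ordered by inclusion. Here $\mathbb{N}$ contains $0$. The group $\mathrm{ZM}(m,n,r)$ (a ZM-group, i.e. a finite group all of whose Sylow subgroups are cyclic) has order $mn$. Define $$L=\left\{(m_1,n_1,s)\in\mathbb{N}^3 \;\middle|\; m_1\mid m,\ n_1\mid n,\ s<m_1,\ m_1\mid s\,\frac{r^n-1}{r^{n_1}-1}\right\},$$ where the quotient $\frac{r^n-1}{r^{n_1}-1}$ is understood as the integer $\sum_{i=0}^{n/n_1-1} r^{i n_1}$ (this matters only when $r^{n_1}=1$). For $(m_1,n_1,s)\in L$ define the subgroup $$H_{(m_1,n_1,s)}=\langle a^{m_1},\, b^{n_1}a^{s}\rangle=\bigcup_{k=1}^{n/n_1}(b^{n_1}a^s)^k\langle a^{m_1}\rangle$$ of $\mathrm{ZM}(m,n,r)$. It is a known fact that $(m_1,n_1,s)\mapsto H_{(m_1,n_1,s)}$ is a bijection from $L$ onto $L(\mathrm{ZM}(m,n,r))$, and that $|H_{(m_1,n_1,s)}|=\frac{mn}{m_1n_1}$. *)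

theory Defs
  imports "HOL-Algebra.Algebra" "HOL-Number_Theory.Cong"
begin

section \<open>Groups given by generators and relations\<close>

text \<open>
  A letter \<open>(x, True)\<close> stands for the generator \<open>x\<close>, and \<open>(x, False)\<close> for its formal inverse.
  A relation \<open>u = v\<close> is a pair of words. The generators are all elements of the type \<open>'g\<close>.
\<close>

type_synonym 'g word = "('g \<times> bool) list"

inductive pres_eq :: "('g word \<times> 'g word) set \<Rightarrow> 'g word \<Rightarrow> 'g word \<Rightarrow> bool"
  for R :: "('g word \<times> 'g word) set" where
  rel: "(u, v) \<in> R \<Longrightarrow> pres_eq R u v"
| cancel: "pres_eq R [(x, e), (x, \<not> e)] []"
| refl: "pres_eq R u u"
| sym: "pres_eq R u v \<Longrightarrow> pres_eq R v u"
| trans: "pres_eq R u v \<Longrightarrow> pres_eq R v w \<Longrightarrow> pres_eq R u w"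
| append: "pres_eq R u v \<Longrightarrow> pres_eq R u' v' \<Longrightarrow> pres_eq R (u @ u') (v @ v')"

definition pres_class :: "('g word \<times> 'g word) set \<Rightarrow> 'g word \<Rightarrow> 'g word set" where
  "pres_class R u = {v. pres_eq R u v}"

definition presented_group :: "('g word \<times> 'g word) set \<Rightarrow> 'g word set monoid" where
  "presented_group R =
     \<lparr>carrier = range (pres_class R),
      monoid.mult = (\<lambda>A B. \<Union>u\<in>A. \<Union>v\<in>B. pres_class R (u @ v)),
      one = pres_class R []\<rparr>"

definition pres_gen :: "('g word \<times> 'g word) set \<Rightarrow> 'g \<Rightarrow> 'g word set" where
  "pres_gen R x = pres_class R [(x, True)]"

definition gen_pow :: "'g \<Rightarrow> int \<Rightarrow> 'g word" where
  "gen_pow x k = replicate (nat \<bar>k\<bar>) (x, 0 \<le> k)"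

lemma pres_class_eq_iff: "pres_class R u = pres_class R v \<longleftrightarrow> pres_eq R u v"
  unfolding pres_class_def
  by (metis (mono_tags) mem_Collect_eq pres_eq.refl pres_eq.sym pres_eq.trans subsetI subset_antisym)

lemma pres_class_mult:
  "pres_class R u \<otimes>\<^bsub>presented_group R\<^esub> pres_class R v = pres_class R (u @ v)"
proof -
  have "pres_class R (u' @ v') = pres_class R (u @ v)"
    if "u' \<in> pres_class R u" "v' \<in> pres_class R v" for u' v'
  proof -
    have "pres_eq R (u @ v) (u' @ v')"
      using that by (simp add: pres_class_def pres_eq.append)
    then show ?thesis
      by (simp add: pres_class_eq_iff pres_eq.sym)
  qed
  moreover have "u \<in> pres_class R u" "v \<in> pres_class R v"
    by (simp_all add: pres_class_def pres_eq.refl)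
  ultimately have "(\<Union>u'\<in>pres_class R u. \<Union>v'\<in>pres_class R v. pres_class R (u' @ v')) = pres_class R (u @ v)"
    by blast
  then show ?thesis
    by (simp add: presented_group_def)
qed

lemma pres_eq_left_inverse:
  "pres_eq R (rev (map (\<lambda>(x, e). (x, \<not> e)) u) @ u) []"
proof (induction u)
  case Nil
  show ?case by (simp add: pres_eq.refl)
next
  case (Cons l u)
  obtain x e where l: "l = (x, e)" by fastforce
  let ?w = "rev (map (\<lambda>(x, e). (x, \<not> e)) u)"
  have "pres_eq R [(x, \<not> e), (x, e)] []"
    using pres_eq.cancel[of R x "\<not> e"] by simp
  then have "pres_eq R (?w @ [(x, \<not> e), (x, e)] @ u) (?w @ [] @ u)"
    by (intro pres_eq.append pres_eq.refl)
  then have "pres_eq R (?w @ [(x, \<not> e), (x, e)] @ u) []"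
    using Cons.IH by (simp add: pres_eq.trans[OF _ Cons.IH])
  then show ?case by (simp add: l)
qed

lemma group_presented_group: "group (presented_group R)"
proof (rule groupI)
  fix A assume "A \<in> carrier (presented_group R)"
  then obtain u where u: "A = pres_class R u"
    by (auto simp: presented_group_def)
  let ?B = "pres_class R (rev (map (\<lambda>(x, e). (x, \<not> e)) u))"
  have "?B \<otimes>\<^bsub>presented_group R\<^esub> A = \<one>\<^bsub>presented_group R\<^esub>"
    unfolding u pres_class_mult
    by (simp add: presented_group_def pres_class_eq_iff pres_eq_left_inverse)
  then show "\<exists>B\<in>carrier (presented_group R). B \<otimes>\<^bsub>presented_group R\<^esub> A = \<one>\<^bsub>presented_group R\<^esub>"
    by (intro bexI[of _ ?B]) (auto simp: presented_group_def)
next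
  fix A assume "A \<in> carrier (presented_group R)"
  then obtain u where u: "A = pres_class R u"
    by (auto simp: presented_group_def)
  have "\<one>\<^bsub>presented_group R\<^esub> = pres_class R []"
    by (simp add: presented_group_def)
  then show "\<one>\<^bsub>presented_group R\<^esub> \<otimes>\<^bsub>presented_group R\<^esub> A = A"
    by (simp add: u pres_class_mult)
next
  fix A B assume "A \<in> carrier (presented_group R)" "B \<in> carrier (presented_group R)"
  then obtain u v where "A = pres_class R u" "B = pres_class R v"
    by (auto simp: presented_group_def)
  then have "A \<otimes>\<^bsub>presented_group R\<^esub> B = pres_class R (u @ v)"
    by (simp add: pres_class_mult)
  then show "A \<otimes>\<^bsub>presented_group R\<^esub> B \<in> carrier (presented_group R)"
    by (simp add: presented_group_def)
next
  fix A B C assume "A \<in> carrier (presented_group R)" "B \<in> carrier (presented_group R)"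
    "C \<in> carrier (presented_group R)"
  then obtain u v w where "A = pres_class R u" "B = pres_class R v" "C = pres_class R w"
    by (auto simp: presented_group_def)
  then show "A \<otimes>\<^bsub>presented_group R\<^esub> B \<otimes>\<^bsub>presented_group R\<^esub> C =
      A \<otimes>\<^bsub>presented_group R\<^esub> (B \<otimes>\<^bsub>presented_group R\<^esub> C)"
    by (simp add: pres_class_mult)
qed (simp add: presented_group_def)

definition word_val :: "('a, 'b) monoid_scheme \<Rightarrow> ('g \<Rightarrow> 'a) \<Rightarrow> 'g word \<Rightarrow> 'a" where
  "word_val K f u =
     foldr (\<lambda>(x, e) y. (if e then f x else inv\<^bsub>K\<^esub> f x) \<otimes>\<^bsub>K\<^esub> y) u \<one>\<^bsub>K\<^esub>"

text \<open>The universal property: an assignment of the generators that respects \<open>R\<close> extends to a homomorphism.\<close>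

lemma presented_group_universal:
  assumes "group K" and f: "\<And>x. f x \<in> carrier K"
    and R: "\<And>u v. (u, v) \<in> R \<Longrightarrow> word_val K f u = word_val K f v"
  shows "\<exists>h \<in> hom (presented_group R) K. \<forall>x. h (pres_gen R x) = f x"
proof -
  interpret K: group K by fact
  have closed: "word_val K f u \<in> carrier K" for u
    by (induction u) (auto simp: word_val_def f)
  have app: "word_val K f (u @ v) = word_val K f u \<otimes>\<^bsub>K\<^esub> word_val K f v" for u v
  proof (induction u)
    case Nil
    show ?case using closed[of v] by (simp add: word_val_def)
  next
    case (Cons l u)
    obtain x e where "l = (x, e)" by fastforce
    then show ?case
      using Cons.IH closed[of u] closed[of v]
      by (simp add: word_val_def K.m_assoc f)
  qed
  have eq: "word_val K f u = word_val K f v" if "pres_eq R u v" for u v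
    using that
  proof induction
    case (cancel x e)
    show ?case by (cases e) (simp_all add: word_val_def f)
  qed (simp_all add: R app)
  define h where "h A = word_val K f (SOME u. A = pres_class R u)" for A
  have h: "h (pres_class R u) = word_val K f u" for u
  proof -
    have "pres_class R u = pres_class R (SOME v. pres_class R u = pres_class R v)"
      by (rule someI[where x = u]) simp
    then show ?thesis
      unfolding h_def using eq by (metis pres_class_eq_iff)
  qed
  have "h \<in> hom (presented_group R) K"
  proof (rule homI)
    fix A assume "A \<in> carrier (presented_group R)"
    then show "h A \<in> carrier K" by (auto simp: presented_group_def h closed)
  next
    fix A B assume "A \<in> carrier (presented_group R)" "B \<in> carrier (presented_group R)"
    then obtain u v where "A = pres_class R u" "B = pres_class R v"
      by (auto simp: presented_group_def)
    then show "h (A \<otimes>\<^bsub>presented_group R\<^esub> B) = h A \<otimes>\<^bsub>K\<^esub> h B"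
      by (simp add: pres_class_mult h app)
  qed
  moreover have "h (pres_gen R x) = f x" for x
    by (simp add: pres_gen_def h word_val_def f)
  ultimately show ?thesis by blast
qed


section \<open>The groups ZM(m,n,r)\<close>

datatype zm_gen = GenA | GenB

text \<open>The relations \<open>a\<^sup>m = 1\<close>, \<open>b\<^sup>n = 1\<close> and \<open>b\<^sup>-\<^sup>1ab = a\<^sup>r\<close>; the integer \<open>r\<close> may be negative.\<close>

definition ZM_rels :: "nat \<Rightarrow> nat \<Rightarrow> int \<Rightarrow> (zm_gen word \<times> zm_gen word) set" where
  "ZM_rels m n r =
     {(gen_pow GenA (int m), []),
      (gen_pow GenB (int n), []),
      ([(GenB, False), (GenA, True), (GenB, True)], gen_pow GenA r)}"

definition ZM :: "nat \<Rightarrow> nat \<Rightarrow> int \<Rightarrow> zm_gen word set monoid" where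
  "ZM m n r = presented_group (ZM_rels m n r)"

definition ZM_a :: "nat \<Rightarrow> nat \<Rightarrow> int \<Rightarrow> zm_gen word set" where
  "ZM_a m n r = pres_gen (ZM_rels m n r) GenA"

definition ZM_b :: "nat \<Rightarrow> nat \<Rightarrow> int \<Rightarrow> zm_gen word set" where
  "ZM_b m n r = pres_gen (ZM_rels m n r) GenB"

text \<open>
  For \<open>n1\<close> dividing \<open>n \<ge> 1\<close> the sum below is \<open>(r\<^sup>n - 1) / (r\<^sup>n\<^sup>1 - 1)\<close>, read as a geometric
  sum so that it also makes sense when \<open>r\<^sup>n\<^sup>1 = 1\<close>.
\<close>

definition ZM_L :: "nat \<Rightarrow> nat \<Rightarrow> int \<Rightarrow> (nat \<times> nat \<times> nat) set" where
  "ZM_L m n r =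
     {(m1, n1, s). m1 dvd m \<and> n1 dvd n \<and> s < m1 \<and>
        int m1 dvd int s * (\<Sum>i<n div n1. r ^ (i * n1))}"

definition ZM_L' :: "nat \<Rightarrow> nat \<Rightarrow> int \<Rightarrow> (nat \<times> nat \<times> nat) set" where
  "ZM_L' m n r =
     {(m1, n1, s). int m1 dvd gcd (int m) (r ^ n1 - 1) \<and> n1 dvd n \<and> s = 0}"

definition ZM_H :: "nat \<Rightarrow> nat \<Rightarrow> int \<Rightarrow> nat \<times> nat \<times> nat \<Rightarrow> zm_gen word set set" where
  "ZM_H m n r = (\<lambda>(m1, n1, s).
     generate (ZM m n r)
       {ZM_a m n r [^]\<^bsub>ZM m n r\<^esub> m1,
        (ZM_b m n r [^]\<^bsub>ZM m n r\<^esub> n1) \<otimes>\<^bsub>ZM m n r\<^esub> (ZM_a m n r [^]\<^bsub>ZM m n r\<^esub> s)})"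

definition normal_subgroups :: "('a, 'b) monoid_scheme \<Rightarrow> 'a set set" where
  "normal_subgroups G = {N. N \<lhd> G}"

end

theory Submission
  imports Defs
begin

text \<open>
  Every element of the group has the form \<open>b\<^sup>i a\<^sup>j\<close>. If it lies in a normal subgroup \<open>N\<close>, so does its
  conjugate by \<open>b\<close>, which is \<open>b\<^sup>i a\<^sup>k\<close> with \<open>k = r j\<close>; hence \<open>N\<close> contains \<open>a\<close> to the power
  \<open>(r - 1) j\<close>. As \<open>r - 1\<close> is coprime to \<open>m\<close>, both \<open>a\<^sup>j\<close> and \<open>b\<^sup>i\<close> lie in \<open>N\<close>, so \<open>N\<close> is generated
  by a power of \<open>a\<close> and a power of \<open>b\<close>. Conjugating the latter by \<open>a\<close> gives the divisibility
  condition.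
\<close>

section \<open>Powers in subgroups, and normality tested on generators\<close>

lemma (in group) powers_in_subgroup:
  fixes n :: nat
  assumes N: "subgroup N G" and x: "x \<in> carrier G" and n: "n > 0" "x [^] n \<in> N"
  obtains d :: nat where "d dvd n" "\<And>k::int. x [^] k \<in> N \<longleftrightarrow> int d dvd k"
proof -
  \<comment> \<open>The exponents \<open>k\<close> with \<open>x [^] k \<in> N\<close> form a
    subgroup of the integers, which is generated by its least positive element; \<open>n\<close>
    shows that a positive one exists.\<close>
  define d where "d = (LEAST d::nat. d > 0 \<and> x [^] d \<in> N)"
  have d: "d > 0" "x [^] d \<in> N"
    unfolding d_def by (rule LeastI2[of _ n]; use n in auto)+
  have least: "d \<le> e" if "e > 0" "x [^] e \<in> N" for e
    unfolding d_def by (rule Least_le) (use that in auto)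
  have mult: "x [^] (int d * q) \<in> N" for q
    using subgroup_int_pow_closed[OF N d(2), of q] x
    by (simp add: int_pow_pow flip: int_pow_int)
  have iff: "x [^] k \<in> N \<longleftrightarrow> int d dvd k" for k
  proof
    assume k: "x [^] k \<in> N"
    \<comment> \<open>Division with remainder: the remainder is again an exponent with power in
      \<open>N\<close> and is less than \<open>d\<close>, so minimality forces it to be 0.\<close>
    have "k mod int d = k + int d * - (k div int d)"
      by (simp add: minus_mult_div_eq_mod[symmetric])
    then have "x [^] (k mod int d) \<in> N"
      using subgroup.m_closed[OF N k mult] by (simp only: int_pow_mult[OF x])
    then have "x [^] nat (k mod int d) \<in> N"
      using d(1) by (simp flip: int_pow_int)
    then have "\<not> nat (k mod int d) > 0"
      using least[of "nat (k mod int d)"] d(1) pos_mod_bound[of "int d" k] by linarith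
    then show "int d dvd k"
      using d(1) pos_mod_sign[of "int d" k] by (simp add: dvd_eq_mod_eq_0 del: pos_mod_sign)
  qed (auto simp: mult)
  then have "d dvd n"
    using n(2) by (metis int_pow_int int_dvd_int_iff)
  with iff that show ?thesis by blast
qed

lemma (in group) group_hom_conjugation:
  assumes x: "x \<in> carrier G"
  shows "group_hom G G (\<lambda>y. x \<otimes> y \<otimes> inv x)"
proof (intro group_hom.intro group_hom_axioms.intro homI)
  fix y z
  assume yz: "y \<in> carrier G" "z \<in> carrier G"
  have "inv x \<otimes> (x \<otimes> (z \<otimes> inv x)) = z \<otimes> inv x"
    using x yz by (simp flip: m_assoc)
  then show "x \<otimes> (y \<otimes> z) \<otimes> inv x = x \<otimes> y \<otimes> inv x \<otimes> (x \<otimes> z \<otimes> inv x)"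
    using x yz by (simp add: m_assoc)
qed (use x in auto)

text \<open>Conjugation by a fixed element is an endomorphism, so it maps the subgroup generated by
  \<open>H\<close> onto the one generated by the conjugates of \<open>H\<close>.\<close>

lemma (in group) generate_normalI:
  assumes H: "H \<subseteq> carrier G"
    and conj: "\<And>g h. g \<in> carrier G \<Longrightarrow> h \<in> H \<Longrightarrow> inv g \<otimes> h \<otimes> g \<in> generate G H"
  shows "generate G H \<lhd> G"
proof (rule normal_invI)
  show sub: "subgroup (generate G H) G"
    by (rule generate_is_subgroup[OF H])
  fix x h
  assume x: "x \<in> carrier G" and h: "h \<in> generate G H"
  interpret h: group_hom G G "\<lambda>y. x \<otimes> y \<otimes> inv x"
    by (rule group_hom_conjugation[OF x])
  have "generate G ((\<lambda>y. x \<otimes> y \<otimes> inv x) ` H) \<subseteq> generate G H"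
    using conj[of "inv x"] x by (intro generate_subgroup_incl[OF _ sub]) auto
  then show "x \<otimes> h \<otimes> inv x \<in> generate G H"
    using h by (auto simp: h.generate_img[OF H])
qed

section \<open>Normal forms in a group whose elements \<open>a\<close>, \<open>b\<close> satisfy the
  ZM relations\<close>

locale zm_relations = group G for G (structure) +
  fixes a b :: 'a and m n :: nat and r :: int
  assumes a [simp]: "a \<in> carrier G" and b [simp]: "b \<in> carrier G"
    and m: "m > 0" and n: "n > 0"
    and a_pow: "a [^] m = \<one>" and b_pow: "b [^] n = \<one>"
    and conj: "inv b \<otimes> a \<otimes> b = a [^] r"
begin

text \<open>Conjugation by \<open>b\<close> is an endomorphism, so its effect on \<open>a\<close>
  determines its effect on every power of \<open>a\<close>.\<close>

lemma a_b_commute: "a [^] (k::int) \<otimes> b = b \<otimes> a [^] (r * k)"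
proof -
  interpret h: group_hom G G "\<lambda>x. inv b \<otimes> x \<otimes> b"
    using group_hom_conjugation[of "inv b"] by simp
  have "inv b \<otimes> a [^] k \<otimes> b = a [^] (r * k)"
    using h.hom_int_pow[of a k] by (simp add: conj int_pow_pow)
  then show ?thesis
    by (simp add: m_assoc inv_solve_left')
qed

lemma a_b_pow_commute: "a [^] (k::int) \<otimes> b [^] (i::nat) = b [^] i \<otimes> a [^] (k * r ^ i)"
proof (induction i)
  case (Suc i)
  have "a [^] k \<otimes> b [^] Suc i = b [^] i \<otimes> (a [^] (k * r ^ i) \<otimes> b)"
    using Suc by (simp flip: m_assoc)
  also have "\<dots> = b [^] Suc i \<otimes> a [^] (k * r ^ Suc i)"
    by (simp add: a_b_commute m_assoc mult_ac)
  finally show ?case .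
qed simp

text \<open>The exponent of \<open>b\<close> is natural so that \<open>r ^ i\<close> makes sense for
  integer \<open>r\<close>; inverses of \<open>b\<close> are covered because \<open>inv b\<close> is
  the power \<open>n - 1\<close>. The exponent of \<open>a\<close> is an integer since
  \<open>r\<close> may be negative. That \<open>a\<close> and \<open>b\<close> generate the group is
  assumed separately, as \<open>carrier\<close>, where it is needed.\<close>

definition normal_form :: "nat \<Rightarrow> int \<Rightarrow> 'a" where
  "normal_form i j = b [^] i \<otimes> a [^] j"

lemma inv_b: "inv b = b [^] (n - 1)"
  using b_pow n by (intro inv_equality) (simp_all flip: nat_pow_Suc)

lemma left_mult_normal_form:
  "a [^] k \<otimes> normal_form i j = normal_form i (k * r ^ i + j)"
  "b [^] l \<otimes> normal_form i j = normal_form (l + i) j"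
  unfolding normal_form_def
  by (simp_all add: a_b_pow_commute int_pow_mult nat_pow_mult flip: m_assoc)

lemma pow_a_normal_form: "a [^] j = normal_form 0 j"
  and pow_b_normal_form: "b [^] i = normal_form i 0"
  by (simp_all add: normal_form_def)

lemma normal_form_closed [simp]: "normal_form i j \<in> carrier G"
  by (simp add: normal_form_def)

text \<open>Writing the second exponent as \<open>i + l\<close> makes the powers of \<open>b\<close>
  cancel without natural subtraction. All conjugates below reduce to this formula.\<close>

lemma inv_mult_normal_form:
  "inv (normal_form i j) \<otimes> normal_form (i + l) k = normal_form l (k - j * r ^ l)"
proof -
  have "normal_form i j \<otimes> normal_form l (k - j * r ^ l) = b [^] i \<otimes> normal_form l k"
    by (simp add: normal_form_def[of i j] m_assoc left_mult_normal_form(1))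
  then show ?thesis
    by (simp add: left_mult_normal_form(2) inv_solve_left')
qed

text \<open>Conjugation by \<open>b [^] i \<otimes> a [^] j\<close> takes \<open>a [^] d\<close> to
  its power with exponent \<open>r ^ i\<close>, and multiplies \<open>b [^] e\<close> on the right
  by a power of \<open>a\<close> whose exponent is a multiple of \<open>r ^ e - 1\<close>, hence of
  \<open>d\<close>.\<close>

lemma generate_powers_normal:
  assumes carrier: "\<And>x. x \<in> carrier G \<Longrightarrow> \<exists>i j. x = normal_form i j"
    and d: "int d dvd r ^ e - 1"
  shows "generate G {a [^] d, b [^] e} \<lhd> G" (is "generate G ?H \<lhd> G")
proof (rule generate_normalI)
  have sub: "subgroup (generate G ?H) G"
    by (rule generate_is_subgroup) simp
  have a_mem: "a [^] k \<in> generate G ?H" if k: "int d dvd k" for k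
  proof -
    obtain q where "k = int d * q" using k by (elim dvdE)
    then have "a [^] k = (a [^] d) [^] q"
      using int_pow_pow[OF a, of "int d" q] by (simp only: int_pow_int)
    moreover have "a [^] d \<in> generate G ?H"
      by (rule generate.incl) simp
    ultimately show ?thesis
      using subgroup_int_pow_closed[OF sub] by simp
  qed
  fix g h
  assume "g \<in> carrier G" and h: "h \<in> ?H"
  then obtain i j where g: "g = normal_form i j" using carrier by blast
  show "inv g \<otimes> h \<otimes> g \<in> generate G ?H"
  proof (cases "h = a [^] d")
    case True
    have "inv g \<otimes> (a [^] int d \<otimes> g) = a [^] (int d * r ^ i)"
      using inv_mult_normal_form[of i j 0]
      by (simp add: g left_mult_normal_form pow_a_normal_form[of "int d * r ^ i"])
    then show ?thesis
      using a_mem[of "int d * r ^ i"] True by (simp add: g int_pow_int m_assoc)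
  next
    case False
    have "b [^] e \<otimes> g = normal_form (i + e) j"
      by (simp only: g left_mult_normal_form add.commute)
    then have "inv g \<otimes> (b [^] e \<otimes> g) = b [^] e \<otimes> a [^] (j - j * r ^ e)"
      using inv_mult_normal_form[of i j e j] by (simp add: g normal_form_def[of e])
    moreover have "j - j * r ^ e = - j * (r ^ e - 1)"
      by (simp add: algebra_simps)
    then have "a [^] (j - j * r ^ e) \<in> generate G ?H"
      using d by (intro a_mem) simp
    ultimately show ?thesis
      using False h by (simp add: g m_assoc generate.eng generate.incl)
  qed
qed simp

lemma normal_form_mem_normal:
  assumes N: "N \<lhd> G" and mem: "normal_form i j \<in> N" and r: "coprime (int m) (r - 1)"
  shows "a [^] j \<in> N" "b [^] i \<in> N"
proof -
  interpret N: normal N G by fact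
  obtain d where d: "d dvd m" "\<And>k::int. a [^] k \<in> N \<longleftrightarrow> int d dvd k"
    using powers_in_subgroup[OF N.subgroup_axioms a m] a_pow by auto
  have "normal_form i j \<otimes> b = normal_form (Suc i) (r * j)"
    by (simp add: normal_form_def m_assoc a_b_commute)
  also have "\<dots> = b \<otimes> normal_form i (r * j)"
    using left_mult_normal_form(2)[of 1 i] by simp
  finally have "inv b \<otimes> normal_form i j \<otimes> b = normal_form i (r * j)"
    by (simp add: m_assoc inv_solve_left')
  then have "normal_form i (r * j) \<in> N"
    using N.inv_op_closed1[OF b mem] by simp
  moreover have "inv (normal_form i j) \<otimes> normal_form i (r * j) = a [^] ((r - 1) * j)"
    using inv_mult_normal_form[of i j 0] by (simp add: pow_a_normal_form algebra_simps)
  \<comment> \<open>Membership in \<open>N\<close> of a power of \<open>a\<close> is divisibility by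
    \<open>d\<close>. The factor \<open>r - 1\<close> then cancels, being coprime to
    \<open>d\<close> because \<open>d\<close> divides \<open>m\<close>.\<close>
  ultimately have "int d dvd (r - 1) * j"
    using mem N.m_closed N.m_inv_closed d(2) by metis
  moreover have "coprime (int d) (r - 1)"
    using d(1) r by (meson coprime_divisors dvd_refl int_dvd_int_iff)
  ultimately show j: "a [^] j \<in> N"
    by (simp add: d(2) coprime_dvd_mult_right_iff)
  have "normal_form i j \<otimes> inv (a [^] j) = b [^] i"
    by (simp add: normal_form_def m_assoc)
  then show "b [^] i \<in> N"
    using mem j N.m_closed N.m_inv_closed by metis
qed

lemma normal_eq_generate_powers:
  assumes carrier: "\<And>x. x \<in> carrier G \<Longrightarrow> \<exists>i j. x = normal_form i j"
    and N: "N \<lhd> G" and r: "coprime (int m) (r - 1)"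
  obtains d e where "d dvd m" "e dvd n" "int d dvd r ^ e - 1" "N = generate G {a [^] d, b [^] e}"
proof -
  interpret N: normal N G by fact
  obtain d where d: "d dvd m" "\<And>k::int. a [^] k \<in> N \<longleftrightarrow> int d dvd k"
    using powers_in_subgroup[OF N.subgroup_axioms a m] a_pow by auto
  obtain e where e: "e dvd n" "\<And>k::int. b [^] k \<in> N \<longleftrightarrow> int e dvd k"
    using powers_in_subgroup[OF N.subgroup_axioms b n] b_pow by auto
  let ?M = "generate G {a [^] d, b [^] e}"
  have ad: "a [^] d \<in> N" and be: "b [^] e \<in> N"
    using d(2)[of "int d"] e(2)[of "int e"] by (simp_all add: int_pow_int)
  \<comment> \<open>This conjugate of \<open>b [^] e\<close> lies in \<open>N\<close>, so its
    \<open>a\<close>-part does too, which is the divisibility of \<open>r ^ e - 1\<close> by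
    \<open>d\<close>.\<close>
  have "inv a \<otimes> (b [^] e \<otimes> a) = normal_form e (1 - r ^ e)"
    using inv_mult_normal_form[of 0 1 e 1] by (simp add: normal_form_def)
  then have "normal_form e (1 - r ^ e) \<in> N"
    using N.inv_op_closed1[OF a be] by (simp add: m_assoc)
  then have "int d dvd 1 - r ^ e"
    using normal_form_mem_normal[OF N _ r] d(2) by blast
  then have dvd: "int d dvd r ^ e - 1"
    by (simp add: dvd_diff_commute)
  have M: "subgroup ?M G"
    by (rule generate_is_subgroup) simp
  have "N \<subseteq> ?M"
  proof
    fix x assume x: "x \<in> N"
    then obtain i j where x_eq: "x = normal_form i j"
      using carrier N.mem_carrier by blast
    \<comment> \<open>Both factors of the normal form lie in \<open>N\<close> separately, so each is
      a power of the corresponding generator.\<close>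
    then have ij: "int d dvd j" "int e dvd int i"
      using normal_form_mem_normal[OF N _ r] x d(2) e(2)[of "int i"] by (auto simp: int_pow_int)
    then obtain p q where "j = int d * p" "int i = int e * q"
      by (elim dvdE)
    then have "x = (b [^] e) [^] q \<otimes> (a [^] d) [^] p"
      by (simp add: x_eq normal_form_def int_pow_pow flip: int_pow_int)
    then show "x \<in> ?M"
      using subgroup.m_closed[OF M] subgroup_int_pow_closed[OF M] generate.incl
      by (metis insertCI)
  qed
  moreover have "?M \<subseteq> N"
    using ad be by (intro generate_subgroup_incl N.subgroup_axioms) auto
  ultimately show thesis
    using that d(1) e(1) dvd by blast
qed

end

section \<open>From words to the ZM relations and normal forms in the presented group\<close>

lemma one_presented_group: "\<one>\<^bsub>presented_group R\<^esub> = pres_class R []"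
  by (simp add: presented_group_def)

lemma pres_gen_closed: "pres_gen R x \<in> carrier (presented_group R)"
  by (simp add: pres_gen_def presented_group_def)

lemma inv_pres_gen: "inv\<^bsub>presented_group R\<^esub> pres_gen R x = pres_class R [(x, False)]"
proof -
  interpret group "presented_group R" by (rule group_presented_group)
  have "pres_class R [(x, False)] \<otimes>\<^bsub>presented_group R\<^esub> pres_gen R x = \<one>\<^bsub>presented_group R\<^esub>"
    using pres_eq.cancel[of R x False]
    by (simp add: pres_gen_def pres_class_mult one_presented_group pres_class_eq_iff)
  then show ?thesis
    using pres_gen_closed by (intro inv_equality) (auto simp: presented_group_def)
qed

lemma pres_class_replicate:
  "pres_class R (replicate k l) = pres_class R [l] [^]\<^bsub>presented_group R\<^esub> k"
proof (induction k)
  case (Suc k)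
  have "replicate (Suc k) l = replicate k l @ [l]"
    by (simp add: replicate_append_same)
  then show ?case
    by (simp only: pres_class_mult[symmetric] Suc nat_pow_Suc)
qed (simp add: one_presented_group)

text \<open>\<open>gen_pow\<close> encodes a negative exponent by repeating the inverse letter,
  whose class is the inverse of the generator.\<close>

lemma pres_class_gen_pow:
  "pres_class R (gen_pow x k) = pres_gen R x [^]\<^bsub>presented_group R\<^esub> k"
proof -
  interpret group "presented_group R" by (rule group_presented_group)
  show ?thesis
  proof (cases "0 \<le> k")
    case True
    then show ?thesis
      by (simp only: gen_pow_def pres_class_replicate int_pow_def2 pres_gen_def) simp
  next
    case False
    then have "pres_class R (gen_pow x k)
        = (inv\<^bsub>presented_group R\<^esub> pres_gen R x) [^]\<^bsub>presented_group R\<^esub> nat (- k)"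
      by (simp only: gen_pow_def pres_class_replicate inv_pres_gen) simp
    also have "\<dots> = pres_gen R x [^]\<^bsub>presented_group R\<^esub> k"
      using False by (simp only: nat_pow_inv[OF pres_gen_closed] int_pow_def2) simp
    finally show ?thesis .
  qed
qed

lemma pres_class_eq_if_rel: "(u, v) \<in> R \<Longrightarrow> pres_class R u = pres_class R v"
  by (simp add: pres_class_eq_iff pres_eq.rel)

lemma zm_relations_ZM:
  assumes "m > 0" "n > 0"
  shows "zm_relations (ZM m n r) (ZM_a m n r) (ZM_b m n r) m n r"
proof -
  let ?R = "ZM_rels m n r"
  interpret group "ZM m n r"
    unfolding ZM_def by (rule group_presented_group)
  show ?thesis
  proof
    show "ZM_a m n r [^]\<^bsub>ZM m n r\<^esub> m = \<one>\<^bsub>ZM m n r\<^esub>"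
      using pres_class_eq_if_rel[of "gen_pow GenA (int m)" "[]" ?R]
      by (simp add: ZM_rels_def pres_class_gen_pow ZM_def ZM_a_def one_presented_group int_pow_int)
    show "ZM_b m n r [^]\<^bsub>ZM m n r\<^esub> n = \<one>\<^bsub>ZM m n r\<^esub>"
      using pres_class_eq_if_rel[of "gen_pow GenB (int n)" "[]" ?R]
      by (simp add: ZM_rels_def pres_class_gen_pow ZM_def ZM_b_def one_presented_group int_pow_int)
    show "inv\<^bsub>ZM m n r\<^esub> ZM_b m n r \<otimes>\<^bsub>ZM m n r\<^esub> ZM_a m n r \<otimes>\<^bsub>ZM m n r\<^esub> ZM_b m n r
        = ZM_a m n r [^]\<^bsub>ZM m n r\<^esub> r"
      using pres_class_eq_if_rel[of "[(GenB, False), (GenA, True), (GenB, True)]" "gen_pow GenA r" ?R]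
      by (simp add: ZM_rels_def pres_class_gen_pow ZM_def ZM_a_def ZM_b_def inv_pres_gen)
         (simp add: pres_gen_def pres_class_mult)
  qed (use assms in \<open>simp_all add: ZM_def ZM_a_def ZM_b_def pres_gen_closed\<close>)
qed

text \<open>The normal forms include the identity and are stable under left multiplication by a
  generator or its inverse, so induction on words reaches every class.\<close>

lemma ZM_carrier_normal_form:
  assumes "m > 0" "n > 0" and x: "x \<in> carrier (ZM m n r)"
  shows "\<exists>i j. x = zm_relations.normal_form (ZM m n r) (ZM_a m n r) (ZM_b m n r) i j"
proof -
  let ?R = "ZM_rels m n r"
  interpret zm_relations "ZM m n r" "ZM_a m n r" "ZM_b m n r" m n r
    by (rule zm_relations_ZM[OF assms(1,2)])
  have letter: "\<exists>i' j'. pres_class ?R [(y, e)] \<otimes>\<^bsub>ZM m n r\<^esub> normal_form i j = normal_form i' j'"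
    for y e i j
  proof (cases y)
    case GenA
    have "pres_class ?R [(y, e)] = ZM_a m n r [^]\<^bsub>ZM m n r\<^esub> (if e then 1 else - 1 :: int)"
      using inv_pres_gen[of ?R GenA] a
      by (simp add: GenA int_pow_neg) (simp add: ZM_a_def ZM_def pres_gen_def)
    then show ?thesis by (metis left_mult_normal_form(1))
  next
    case GenB
    \<comment> \<open>The letter for the inverse of \<open>b\<close> is read as the natural power
      \<open>n - 1\<close>, as the exponent of \<open>b\<close> in \<open>normal_form\<close>
      requires.\<close>
    have "pres_class ?R [(y, e)] = ZM_b m n r [^]\<^bsub>ZM m n r\<^esub> (if e then 1 else n - 1)"
      using inv_pres_gen[of ?R GenB] b inv_b
      by (auto simp: GenB) (simp_all add: ZM_b_def ZM_def pres_gen_def)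
    then show ?thesis by (metis left_mult_normal_form(2))
  qed
  have "\<exists>i j. pres_class ?R u = normal_form i j" for u
  proof (induction u)
    case Nil
    show ?case
      using pow_a_normal_form[of 0] by (auto simp: ZM_def one_presented_group)
  next
    case (Cons l u)
    have "pres_class ?R (l # u) = pres_class ?R [l] \<otimes>\<^bsub>ZM m n r\<^esub> pres_class ?R u"
      by (simp add: ZM_def pres_class_mult)
    then show ?case
      using Cons letter by (metis surj_pair)
  qed
  then show ?thesis
    using x by (auto simp: ZM_def presented_group_def)
qed

section \<open>The normal subgroups of ZM(m,n,r)\<close>

theorem theorem1:
  fixes m n :: nat and r :: int
  assumes "m \<ge> 1" and "n \<ge> 1"
    and "gcd m n = 1" and "gcd (int m) (r - 1) = 1"
    and "[r ^ n = 1] (mod int m)"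
  shows "ZM_L' m n r \<subseteq> ZM_L m n r \<and>
    normal_subgroups (ZM m n r) = {ZM_H m n r t | t. t \<in> ZM_L' m n r}"
proof (intro conjI equalityI subsetI)
  have pos: "m > 0" "n > 0" using assms by auto
  interpret zm_relations "ZM m n r" "ZM_a m n r" "ZM_b m n r" m n r
    by (rule zm_relations_ZM[OF pos])
  \<comment> \<open>With \<open>s = 0\<close> the factor \<open>a [^] s\<close> is trivial, so the
    second generator is a pure power of \<open>b\<close>.\<close>
  have H: "ZM_H m n r (d, e, 0) =
      generate (ZM m n r) {ZM_a m n r [^]\<^bsub>ZM m n r\<^esub> d, ZM_b m n r [^]\<^bsub>ZM m n r\<^esub> e}" for d e
    by (simp add: ZM_H_def)
  note carrier = ZM_carrier_normal_form[OF pos]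
  \<comment> \<open>With \<open>s = 0\<close> the divisibility of the geometric sum is trivial, and
    \<open>s < m1\<close> holds because a divisor of \<open>m > 0\<close> is positive.\<close>
  show "t \<in> ZM_L m n r" if "t \<in> ZM_L' m n r" for t
    using that pos by (auto simp: ZM_L'_def ZM_L_def intro!: Nat.gr0I)
  show "N \<in> {ZM_H m n r t | t. t \<in> ZM_L' m n r}" if N: "N \<in> normal_subgroups (ZM m n r)" for N
  proof -
    obtain d e where "d dvd m" "e dvd n" "int d dvd r ^ e - 1" "N = ZM_H m n r (d, e, 0)"
      using normal_eq_generate_powers[OF carrier, of N] N assms(4)
      by (auto simp: normal_subgroups_def H coprime_iff_gcd_eq_1)
    then show ?thesis
      by (auto simp: ZM_L'_def)
  qed
  show "N \<in> normal_subgroups (ZM m n r)" if "N \<in> {ZM_H m n r t | t. t \<in> ZM_L' m n r}" for N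
    using that generate_powers_normal[OF carrier]
    by (auto simp: ZM_L'_def normal_subgroups_def H)
qed

end
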